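(* Let $H$ be a complex Hilbert space with $\dim H=2$, and let $A\in B(H)$. Then the following conditions are mutually equivalent: (i) $A\perp_R I$, i.e. $\|A+\lambda I\|=\|A-\lambda I\|$ for all $\lambda\in\mathbb{C}$; (ii) $W(A)=-W(A)$; (iii) $\mathrm{tr}(A)=0$.
   Context: $B(H)$ is the $C^*$-algebra of bounded linear maps on $H$ with the operator norm, and $I$ is the identity operator on $H$. For elements $x,y$ of a complex normed linear space, $x$ is Roberts orthogonal to $y$, written $x\perp_R y$, if $\|x+\lambda y\|=\|x-\lambda y\|$ for all $\lambda\in\mathbb{C}$. The classical numerical range of $A$ is $W(A)=\{(Ax,x): x\in H,\ \|x\|=1\}\subseteq\mathbb{C}$, and $-W(A)=\{-z:z\in W(A)\}$. $\mathrm{tr}(A)$ is the trace of $A$. *)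

theory Defs
  imports "HOL-Analysis.Analysis"
begin

section \<open>Complex normed and Hilbert spaces\<close>

class scaleC =
  fixes scaleC :: "complex \<Rightarrow> 'a \<Rightarrow> 'a"  (infixr \<open>*\<^sub>C\<close> 75)

class complex_normed_vector = real_normed_vector + scaleC +
  assumes scaleC_add_right: "a *\<^sub>C (x + y) = a *\<^sub>C x + a *\<^sub>C y"
    and scaleC_add_left: "(a + b) *\<^sub>C x = a *\<^sub>C x + b *\<^sub>C x"
    and scaleC_scaleC: "a *\<^sub>C b *\<^sub>C x = (a * b) *\<^sub>C x"
    and scaleR_eq_scaleC: "r *\<^sub>R x = complex_of_real r *\<^sub>C x"
    and norm_scaleC: "norm (a *\<^sub>C x) = cmod a * norm x"

global_interpretation cvs: vector_space "scaleC :: complex \<Rightarrow> 'a \<Rightarrow> 'a::complex_normed_vector"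
proof
  fix x :: 'a
  show "1 *\<^sub>C x = x"
    using scaleR_eq_scaleC[of 1 x] by simp
qed (simp_all add: scaleC_add_right scaleC_add_left scaleC_scaleC)

text \<open>The inner product is linear in its first argument and induces the norm
  (positive definiteness is part of \<open>cinner_self\<close>).\<close>

class complex_inner = complex_normed_vector +
  fixes cinner :: "'a \<Rightarrow> 'a \<Rightarrow> complex"
  assumes cinner_commute: "cinner x y = cnj (cinner y x)"
    and cinner_add_left: "cinner (x + y) z = cinner x z + cinner y z"
    and cinner_scaleC_left: "cinner (a *\<^sub>C x) y = a * cinner x y"
    and cinner_self: "cinner x x = complex_of_real ((norm x)\<^sup>2)"

class chilbert_space = complex_inner + complete_space


section \<open>The normed space of bounded operators\<close>

lemma clinear_iff:
  fixes f :: "'a::complex_normed_vector \<Rightarrow> 'b::complex_normed_vector"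
  shows "Vector_Spaces.linear (*\<^sub>C) (*\<^sub>C) f \<longleftrightarrow>
    (\<forall>x y. f (x + y) = f x + f y) \<and> (\<forall>c x. f (c *\<^sub>C x) = c *\<^sub>C f x)"
  by (simp add: Vector_Spaces.linear_iff cvs.vector_space_axioms)

lemma bounded_linear_scaleC:
  "bounded_linear (\<lambda>x :: 'a::complex_normed_vector. c *\<^sub>C x)"
  by (rule bounded_linear_intro[where K = "cmod c"])
    (simp_all add: scaleC_add_right scaleR_eq_scaleC scaleC_scaleC norm_scaleC mult.commute)

lemma onorm_scaleC:
  fixes f :: "'a::complex_normed_vector \<Rightarrow> 'b::complex_normed_vector"
  assumes "bounded_linear f"
  shows "onorm (\<lambda>x. c *\<^sub>C f x) = cmod c * onorm f"
proof (cases "c = 0")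
  case True
  then show ?thesis by (simp add: onorm_zero)
next
  case False
  have le: "onorm (\<lambda>x. d *\<^sub>C g x) \<le> cmod d * onorm g"
    if "bounded_linear g" for d and g :: "'a \<Rightarrow> 'b"
    using onorm[OF that] onorm_pos_le[OF that]
    by (intro onorm_bound) (simp_all add: norm_scaleC mult.assoc mult_left_mono)
  have "bounded_linear (\<lambda>x. c *\<^sub>C f x)"
    by (rule bounded_linear_compose[OF bounded_linear_scaleC assms])
  from le[OF this, of "inverse c"] False
  have "onorm f \<le> onorm (\<lambda>x. c *\<^sub>C f x) / cmod c"
    by (simp add: scaleC_scaleC norm_inverse norm_divide field_simps)
  with le[OF assms, of c] False show ?thesis
    by (simp add: field_simps)
qed

typedef (overloaded) 'a bounded_op =
  "{f :: 'a::complex_normed_vector \<Rightarrow> 'a. Vector_Spaces.linear (*\<^sub>C) (*\<^sub>C) f \<and> bounded_linear f}"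
  morphisms op_apply Bounded_Op
  by (rule exI[of _ "\<lambda>x. x"]) (simp add: cvs.linear_ident)

setup_lifting type_definition_bounded_op

instantiation bounded_op :: (complex_normed_vector) complex_normed_vector
begin

lift_definition norm_bounded_op :: "'a bounded_op \<Rightarrow> real" is onorm .

lift_definition zero_bounded_op :: "'a bounded_op" is "\<lambda>x. 0"
  by (simp add: clinear_iff)

lift_definition plus_bounded_op :: "'a bounded_op \<Rightarrow> 'a bounded_op \<Rightarrow> 'a bounded_op"
  is "\<lambda>f g x. f x + g x"
  by (simp add: clinear_iff scaleC_add_right bounded_linear_add)

lift_definition minus_bounded_op :: "'a bounded_op \<Rightarrow> 'a bounded_op \<Rightarrow> 'a bounded_op"
  is "\<lambda>f g x. f x - g x"
  by (simp add: clinear_iff cvs.scale_right_diff_distrib bounded_linear_sub)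

lift_definition uminus_bounded_op :: "'a bounded_op \<Rightarrow> 'a bounded_op" is "\<lambda>f x. - f x"
  by (simp add: clinear_iff cvs.scale_minus_right bounded_linear_minus)

lift_definition scaleC_bounded_op :: "complex \<Rightarrow> 'a bounded_op \<Rightarrow> 'a bounded_op"
  is "\<lambda>c f x. c *\<^sub>C f x"
  by (auto simp: clinear_iff scaleC_add_right scaleC_scaleC mult.commute
      intro: bounded_linear_compose[OF bounded_linear_scaleC])

lift_definition scaleR_bounded_op :: "real \<Rightarrow> 'a bounded_op \<Rightarrow> 'a bounded_op"
  is "\<lambda>r f x. r *\<^sub>R f x"
  by (auto simp: clinear_iff scaleR_eq_scaleC scaleC_add_right scaleC_scaleC mult.commute
      intro: bounded_linear_compose[OF bounded_linear_scaleC])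

definition dist_bounded_op :: "'a bounded_op \<Rightarrow> 'a bounded_op \<Rightarrow> real"
  where "dist_bounded_op f g = norm (f - g)"

definition
  "(uniformity :: ('a bounded_op \<times> 'a bounded_op) filter) =
    (INF e\<in>{0 <..}. principal {(x, y). dist x y < e})"

definition open_bounded_op :: "'a bounded_op set \<Rightarrow> bool"
  where "open_bounded_op S =
    (\<forall>x\<in>S. \<forall>\<^sub>F (x', y) in uniformity. x' = x \<longrightarrow> y \<in> S)"

definition sgn_bounded_op :: "'a bounded_op \<Rightarrow> 'a bounded_op"
  where "sgn_bounded_op f = inverse (norm f) *\<^sub>R f"

instance
proof
  fix f g h :: "'a bounded_op" and a b :: complex and r s :: real
  show "f + g + h = f + (g + h)" "f + g = g + f" "0 + f = f" "- f + f = 0" "f - g = f + - g"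
    by (transfer; simp add: fun_eq_iff)+
  show "r *\<^sub>R (f + g) = r *\<^sub>R f + r *\<^sub>R g" "(r + s) *\<^sub>R f = r *\<^sub>R f + s *\<^sub>R f"
    "r *\<^sub>R s *\<^sub>R f = (r * s) *\<^sub>R f" "1 *\<^sub>R f = f"
    by (transfer; simp add: fun_eq_iff scaleR_add_right scaleR_add_left)+
  show "dist f g = norm (f - g)" by (simp add: dist_bounded_op_def)
  show "sgn f = inverse (norm f) *\<^sub>R f" by (simp add: sgn_bounded_op_def)
  show "(uniformity :: ('a bounded_op \<times> 'a bounded_op) filter) =
      (INF e\<in>{0 <..}. principal {(x, y). dist x y < e})"
    by (simp add: uniformity_bounded_op_def)
  show "open S = (\<forall>x\<in>S. \<forall>\<^sub>F (x', y) in uniformity. x' = x \<longrightarrow> y \<in> S)"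
    for S :: "'a bounded_op set"
    by (simp add: open_bounded_op_def)
  show "norm f = 0 \<longleftrightarrow> f = 0" by transfer (auto simp: onorm_eq_0)
  show "norm (f + g) \<le> norm f + norm g" by transfer (auto intro: onorm_triangle)
  show "norm (r *\<^sub>R f) = \<bar>r\<bar> * norm f" by transfer (auto intro: onorm_scaleR)
  show "a *\<^sub>C (f + g) = a *\<^sub>C f + a *\<^sub>C g" "(a + b) *\<^sub>C f = a *\<^sub>C f + b *\<^sub>C f"
    "a *\<^sub>C b *\<^sub>C f = (a * b) *\<^sub>C f" "r *\<^sub>R f = complex_of_real r *\<^sub>C f"
    by (transfer; simp add: fun_eq_iff scaleC_add_right scaleC_add_left scaleC_scaleC scaleR_eq_scaleC)+
  show "norm (a *\<^sub>C f) = cmod a * norm f" by transfer (simp add: onorm_scaleC)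
qed

end

lift_definition op_id :: "'a::complex_normed_vector bounded_op" is "\<lambda>x. x"
  by (simp add: cvs.linear_ident)


section \<open>Roberts orthogonality, numerical range, trace\<close>

definition roberts_orthogonal :: "'a::complex_normed_vector \<Rightarrow> 'a \<Rightarrow> bool"
    (infix \<open>\<bottom>\<^sub>R\<close> 50)
  where "x \<bottom>\<^sub>R y \<longleftrightarrow> (\<forall>c. norm (x + c *\<^sub>C y) = norm (x - c *\<^sub>C y))"

definition numerical_range :: "'a::complex_inner bounded_op \<Rightarrow> complex set"
  where "numerical_range A = {cinner (op_apply A x) x | x. norm x = 1}"

definition is_basis :: "'a::complex_normed_vector set \<Rightarrow> bool"
  where "is_basis B \<longleftrightarrow> cvs.independent B \<and> cvs.span B = UNIV"

text \<open>The sum of the diagonal entries of the matrix of the operator with respect to some basis,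
  meaningful when the space is finite-dimensional.  Independence of the basis is
  \<open>op_trace_eq\<close> below.\<close>

definition op_trace :: "'a::complex_normed_vector bounded_op \<Rightarrow> complex"
  where "op_trace A =
    (let B = (SOME B. is_basis B) in \<Sum>b\<in>B. cvs.representation B (op_apply A b) b)"

lemma basis_sum_representation:
  assumes "is_basis B" "finite B"
  shows "(\<Sum>b\<in>B. cvs.representation B x b *\<^sub>C b) = x"
  using assms cvs.sum_representation_eq[of B x B] by (auto simp: is_basis_def)

lemma diagonal_sum_basis_independent:
  fixes f :: "'a::complex_normed_vector \<Rightarrow> 'a"
  assumes B: "is_basis B" "finite B" and C: "is_basis C" "finite C"
    and f: "Vector_Spaces.linear (*\<^sub>C) (*\<^sub>C) f"
  shows "(\<Sum>b\<in>B. cvs.representation B (f b) b) = (\<Sum>c\<in>C. cvs.representation C (f c) c)"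
proof -
  let ?r = cvs.representation
  interpret f: Vector_Spaces.linear "(*\<^sub>C)" "(*\<^sub>C)" f by (fact f)
  have lin: "?r D (\<Sum>i\<in>I. u i *\<^sub>C v i) d = (\<Sum>i\<in>I. u i * ?r D (v i) d)"
    if "is_basis D" for D :: "'a set" and d and I :: "'a set" and u v
    using that cvs.representation_sum[of D I "\<lambda>i. u i *\<^sub>C v i"]
    by (simp add: is_basis_def cvs.representation_scale)
  have "?r B (f b) b = (\<Sum>c\<in>C. ?r C b c * ?r B (f c) b)" for b
  proof -
    have "f b = f (\<Sum>c\<in>C. ?r C b c *\<^sub>C c)"
      by (simp add: basis_sum_representation C)
    also have "\<dots> = (\<Sum>c\<in>C. ?r C b c *\<^sub>C f c)"
      by (simp add: f.sum f.scale)
    finally show ?thesis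
      using lin[OF B(1)] by simp
  qed
  then have "(\<Sum>b\<in>B. ?r B (f b) b) = (\<Sum>b\<in>B. \<Sum>c\<in>C. ?r C b c * ?r B (f c) b)"
    by simp
  also have "\<dots> = (\<Sum>c\<in>C. \<Sum>b\<in>B. ?r B (f c) b * ?r C b c)"
    by (subst sum.swap) (simp add: mult.commute)
  also have "\<dots> = (\<Sum>c\<in>C. ?r C (\<Sum>b\<in>B. ?r B (f c) b *\<^sub>C b) c)"
    by (simp add: lin[OF C(1)])
  finally show ?thesis
    by (simp add: basis_sum_representation B)
qed

lemma op_trace_eq:
  fixes A :: "'a::complex_normed_vector bounded_op"
  assumes "is_basis B" "finite B"
  shows "op_trace A = (\<Sum>b\<in>B. cvs.representation B (op_apply A b) b)"
proof -
  define C :: "'a set" where "C = (SOME C. is_basis C)"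
  have C: "is_basis C"
    unfolding C_def using assms(1) by (rule someI)
  have "finite C"
    using cvs.independent_span_bound[of B C] assms C by (auto simp: is_basis_def)
  then show ?thesis
    unfolding op_trace_def Let_def C_def[symmetric]
    using C assms op_apply[of A] by (intro diagonal_sum_basis_independent) auto
qed

end

theory Submission
  imports Defs
begin

text \<open>
  Fix an orthonormal basis of the plane \<open>H\<close> and let \<open>J (x\<^sub>1, x\<^sub>2) = (- cnj x\<^sub>2, cnj x\<^sub>1)\<close>,
  an antiunitary map that turns every vector into an orthogonal one.  Conjugation by \<open>J\<close> carries
  the adjoint of \<open>A\<close> to the adjugate \<open>tr A \<cdot> I - A\<close>; in terms of forms,
  \<open>(A J x, J y) = tr A (y, x) - (A y, x)\<close> (lemma \<open>cinner_perp\<close>).  Since \<open>J\<close> preserves norms, this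
  one identity shows, for every operator \<open>A\<close>, that both objects of the theorem are symmetric about
  a centre determined by the trace:

  \<^item> \<open>z \<in> W(A)\<close> implies \<open>tr A - z \<in> W(A)\<close> (\<open>numerical_range_reflect\<close>);
  \<^item> \<open>A + c I\<close> and \<open>(tr A + c) I - A\<close> have the same norm (\<open>norm_shift_reflect\<close>).

  If \<open>tr A = 0\<close>, these symmetries are exactly \<open>W(A) = - W(A)\<close> and \<open>A \<bottom>\<^sub>R I\<close>.  Conversely, if one of
  those two conditions holds, then \<open>W(A)\<close>, or the function \<open>c \<mapsto> \<parallel>A + c I\<parallel>\<close>, has two centres of
  symmetry differing by \<open>tr A / 2\<close> up to sign, and composing the two reflections makes it invariant
  under translation by \<open>tr A\<close>.  Iterating the translation contradicts boundedness unless
  \<open>tr A = 0\<close> (\<open>bounded_translates_imp_zero\<close>).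
\<close>

section \<open>Complex inner product spaces\<close>

lemma cinner_add_right:
  fixes x :: "'a::complex_inner"
  shows "cinner x (y + z) = cinner x y + cinner x z"
  by (metis cinner_add_left cinner_commute complex_cnj_add)

lemma cinner_scaleC_right:
  fixes x :: "'a::complex_inner"
  shows "cinner x (c *\<^sub>C y) = cnj c * cinner x y"
  by (metis cinner_scaleC_left cinner_commute complex_cnj_mult)

lemma cinner_diff_left:
  fixes x :: "'a::complex_inner"
  shows "cinner (x - y) z = cinner x z - cinner y z"
  by (metis cinner_add_left diff_add_cancel eq_diff_eq)

lemma cinner_diff_right:
  fixes x :: "'a::complex_inner"
  shows "cinner z (x - y) = cinner z x - cinner z y"
  by (metis cinner_add_right diff_add_cancel eq_diff_eq)

lemma cinner_self_nonneg:
  fixes x :: "'a::complex_inner"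
  shows "Re (cinner x x) \<ge> 0"
  by (simp add: cinner_self)

text \<open>It suffices to expand \<open>\<parallel>b x - (x, y) y\<parallel>\<^sup>2 \<ge> 0\<close> with \<open>b = \<parallel>y\<parallel>\<^sup>2\<close>.\<close>

lemma cmod_cinner_le:
  fixes x y :: "'a::complex_inner"
  shows "cmod (cinner x y) \<le> norm x * norm y"
proof (cases "y = 0")
  case True
  have "cinner x 0 = 0"
    using cinner_diff_right[of x x x] by simp
  then show ?thesis
    using True by simp
next
  case False
  define c b where "c = cinner x y" and "b = (norm y)\<^sup>2"
  define w where "w = complex_of_real b *\<^sub>C x - c *\<^sub>C y"
  have yx: "cinner y x = cnj c"
    unfolding c_def by (rule cinner_commute)
  have "cinner w w =
      of_real b * of_real b * of_real ((norm x)\<^sup>2) - of_real b * (c * cnj c)"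
    unfolding w_def
    by (simp add: cinner_diff_left cinner_diff_right cinner_scaleC_left cinner_scaleC_right
        cinner_self[of x] cinner_self[of y] yx c_def[symmetric] b_def[symmetric] algebra_simps
        del: of_real_power)
  then have "cinner w w = of_real (b * (b * (norm x)\<^sup>2 - (cmod c)\<^sup>2))"
    by (simp add: complex_norm_square[symmetric] algebra_simps)
  then have "0 \<le> b * (b * (norm x)\<^sup>2 - (cmod c)\<^sup>2)"
    using cinner_self_nonneg[of w] by simp
  moreover have "b > 0"
    using False by (simp add: b_def)
  ultimately have "(cmod c)\<^sup>2 \<le> (norm x * norm y)\<^sup>2"
    by (simp add: zero_le_mult_iff b_def power_mult_distrib mult.commute)
  then show ?thesis
    unfolding c_def by (rule power2_le_imp_le) simp
qed

section \<open>Bounded operators\<close>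

lemma op_apply_add: "op_apply A (x + y) = op_apply A x + op_apply A y"
  and op_apply_scaleC: "op_apply A (c *\<^sub>C x) = c *\<^sub>C op_apply A x"
  using op_apply[of A] by (auto simp: clinear_iff)

lemma norm_op_apply_le: "norm (op_apply A x) \<le> norm A * norm x"
  using op_apply[of A] by (auto simp: norm_bounded_op.rep_eq intro: onorm)

lemma norm_op_le:
  assumes "\<And>x. norm (op_apply A x) \<le> K * norm x" and "0 \<le> K"
  shows "norm A \<le> K"
  unfolding norm_bounded_op.rep_eq using assms by (intro onorm_bound)

lemmas op_apply_simps =
  plus_bounded_op.rep_eq minus_bounded_op.rep_eq scaleC_bounded_op.rep_eq op_id.rep_eq

lemma numerical_range_bounded:
  assumes "z \<in> numerical_range A"
  shows "cmod z \<le> norm A"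
proof -
  obtain x where x: "z = cinner (op_apply A x) x" "norm x = 1"
    using assms by (auto simp: numerical_range_def)
  show ?thesis
    using cmod_cinner_le[of "op_apply A x" x] norm_op_apply_le[of A x] x by simp
qed

lemma bounded_translates_imp_zero:
  fixes x v :: "'a::real_normed_vector"
  assumes "\<And>n::nat. norm (x + real n *\<^sub>R v) \<le> K"
  shows "v = 0"
proof (rule ccontr)
  assume "v \<noteq> 0"
  then obtain n :: nat where n: "K + norm x < real n * norm v"
    using reals_Archimedean3[of "norm v"] by auto
  have "real n * norm v = norm ((x + real n *\<^sub>R v) - x)"
    by simp
  also have "\<dots> \<le> K + norm x"
    using norm_triangle_ineq4[of "x + real n *\<^sub>R v" x] assms[of n] by linarith
  finally show False
    using n by simp
qed

section \<open>The plane in orthonormal coordinates\<close>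

locale orthonormal_plane =
  fixes e f :: "'h::complex_inner"
  assumes norm_e: "norm e = 1" and norm_f: "norm f = 1"
    and orthogonal: "cinner e f = 0"
    and expansion: "x = cinner x e *\<^sub>C e + cinner x f *\<^sub>C f"
begin

lemma cinner_basis [simp]:
  "cinner e e = 1" "cinner f f = 1" "cinner e f = 0" "cinner f e = 0"
  using norm_e norm_f orthogonal cinner_commute[of f e] by (simp_all add: cinner_self)

lemma cinner_coordinates:
  "cinner x y = cinner x e * cnj (cinner y e) + cinner x f * cnj (cinner y f)"
  by (subst expansion[of y]) (simp add: cinner_add_right cinner_scaleC_right)

lemma cinner_op_coordinates:
  "cinner (op_apply A x) y =
     cinner x e * (cinner (op_apply A e) e * cnj (cinner y e)
       + cinner (op_apply A e) f * cnj (cinner y f))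
   + cinner x f * (cinner (op_apply A f) e * cnj (cinner y e)
       + cinner (op_apply A f) f * cnj (cinner y f))"
proof -
  have "op_apply A x = cinner x e *\<^sub>C op_apply A e + cinner x f *\<^sub>C op_apply A f"
    by (subst expansion[of x]) (simp add: op_apply_add op_apply_scaleC)
  then have "cinner (op_apply A x) y =
      cinner x e * cinner (op_apply A e) y + cinner x f * cinner (op_apply A f) y"
    by (simp add: cinner_add_left cinner_scaleC_left)
  then show ?thesis
    by (simp only: cinner_coordinates[of "op_apply A e" y] cinner_coordinates[of "op_apply A f" y])
qed

lemma is_basis: "is_basis {e, f}"
proof -
  have ef: "e \<noteq> f"
    using cinner_basis by force
  have "x \<in> cvs.span {e, f}" for x
    by (subst expansion) (intro cvs.span_add cvs.span_scale cvs.span_base; simp)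
  moreover have "cvs.independent {e, f}"
  proof -
    have "u e = 0 \<and> u f = 0" if "(\<Sum>v\<in>{e, f}. u v *\<^sub>C v) = 0" for u
    proof -
      have "cinner (u e *\<^sub>C e + u f *\<^sub>C f) x = 0" for x
        using that ef cinner_diff_left[of x x x] by simp
      from this[of e] this[of f] show ?thesis
        by (simp add: cinner_add_left cinner_scaleC_left)
    qed
    then show ?thesis
      by (intro cvs.independent_if_scalars_zero) auto
  qed
  ultimately show ?thesis
    by (auto simp: is_basis_def)
qed

lemma op_trace:
  fixes A :: "'h bounded_op"
  shows "op_trace A = cinner (op_apply A e) e + cinner (op_apply A f) f"
proof -
  have ef: "e \<noteq> f"
    using cinner_basis by force
  have rep: "cvs.representation {e, f} x e = cinner x e"
    "cvs.representation {e, f} x f = cinner x f" for x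
  proof -
    have x: "cvs.representation {e, f} x e *\<^sub>C e + cvs.representation {e, f} x f *\<^sub>C f = x"
      using basis_sum_representation[OF is_basis, of x] ef by simp
    show "cvs.representation {e, f} x e = cinner x e"
      "cvs.representation {e, f} x f = cinner x f"
      using arg_cong[OF x, of "\<lambda>z. cinner z e"] arg_cong[OF x, of "\<lambda>z. cinner z f"]
      by (simp_all add: cinner_add_left cinner_scaleC_left)
  qed
  show ?thesis
    using op_trace_eq[OF is_basis, of A] ef by (simp add: rep)
qed

section \<open>The antiunitary quarter turn\<close>

definition perp :: "'h \<Rightarrow> 'h"
  where "perp x = (- cnj (cinner x f)) *\<^sub>C e + cnj (cinner x e) *\<^sub>C f"

lemma perp_coordinates:
  "cinner (perp x) e = - cnj (cinner x f)" "cinner (perp x) f = cnj (cinner x e)"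
  by (simp_all add: perp_def cinner_add_left cinner_diff_left cinner_scaleC_left)

lemma norm_perp: "norm (perp x) = norm x"
proof -
  have "cinner (perp x) (perp x) = cinner x x"
    by (simp add: cinner_coordinates[of "perp x" "perp x"] cinner_coordinates[of x x]
        perp_coordinates algebra_simps)
  then have "(norm (perp x))\<^sup>2 = (norm x)\<^sup>2"
    by (simp only: cinner_self of_real_eq_iff)
  then show ?thesis
    by simp
qed

text \<open>For a matrix with entries \<open>a, b, c, d\<close>, moving to \<open>perp\<close> exchanges \<open>a\<close> with \<open>d\<close> and negates
  \<open>b\<close> and \<open>c\<close>, which is the adjugate.  The arguments change places because \<open>perp\<close> is
  antilinear.\<close>

lemma cinner_perp:
  "cinner (op_apply A (perp x)) (perp y) =
     op_trace A * cinner y x - cinner (op_apply A y) x"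
  by (simp add: cinner_op_coordinates[of A "perp x" "perp y"] cinner_op_coordinates[of A y x]
      cinner_coordinates[of y x] perp_coordinates op_trace algebra_simps)

lemma numerical_range_reflect:
  fixes A :: "'h bounded_op"
  assumes "z \<in> numerical_range A"
  shows "op_trace A - z \<in> numerical_range A"
proof -
  obtain x where x: "z = cinner (op_apply A x) x" "norm x = 1"
    using assms by (auto simp: numerical_range_def)
  have "cinner (op_apply A (perp x)) (perp x) = op_trace A - z"
    using x by (simp add: cinner_perp cinner_self)
  then show ?thesis
    using x(2) norm_perp[of x] unfolding numerical_range_def by force
qed

lemma
  fixes A B :: "'h bounded_op"
  shows op_trace_add: "op_trace (A + B) = op_trace A + op_trace B"
    and op_trace_diff: "op_trace (A - B) = op_trace A - op_trace B"
    and op_trace_scaleC_id: "op_trace (c *\<^sub>C op_id :: 'h bounded_op) = 2 * c"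
  by (simp_all add: op_trace op_apply_simps cinner_add_left cinner_diff_left cinner_scaleC_left)

text \<open>Write \<open>A'\<close> for the adjugate \<open>tr A \<cdot> I - A\<close>.  Taking \<open>x = A' y\<close> in \<open>cinner_perp\<close> gives
  \<open>\<parallel>A' y\<parallel>\<^sup>2 = (A (perp x), perp y) \<le> \<parallel>A\<parallel> \<parallel>A' y\<parallel> \<parallel>y\<parallel>\<close>, so \<open>\<parallel>A'\<parallel> \<le> \<parallel>A\<parallel>\<close>.  The adjugate of
  the adjugate is \<open>A\<close>, whence equality.\<close>

lemma norm_adjugate:
  fixes A :: "'h bounded_op"
  shows "norm (op_trace A *\<^sub>C op_id - A) = norm A"
proof -
  have le: "norm (op_trace B *\<^sub>C op_id - B) \<le> norm B" for B :: "'h bounded_op"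
  proof (rule norm_op_le)
    fix y
    define x where "x = op_apply (op_trace B *\<^sub>C op_id - B) y"
    have "cinner x x = cinner (op_apply B (perp x)) (perp y)"
      unfolding cinner_perp
      by (subst x_def)
        (simp add: op_apply_simps cinner_diff_left cinner_scaleC_left)
    then have "(norm x)\<^sup>2 = cmod (cinner (op_apply B (perp x)) (perp y))"
      using arg_cong[OF cinner_self[of x], of cmod]
      by (simp add: norm_power)
    also have "\<dots> \<le> norm (op_apply B (perp x)) * norm y"
      using cmod_cinner_le[of "op_apply B (perp x)" "perp y"] by (simp add: norm_perp)
    also have "\<dots> \<le> norm B * norm x * norm y"
      using norm_op_apply_le[of B "perp x"] by (simp add: mult_right_mono norm_perp)
    finally have "norm x * norm x \<le> (norm B * norm y) * norm x"
      by (simp add: power2_eq_square mult_ac)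
    then show "norm x \<le> norm B * norm y"
      by (cases "x = 0") (auto simp: mult_le_cancel_right)
  qed simp
  have "op_trace (op_trace A *\<^sub>C op_id - A) = op_trace A"
    by (simp add: op_trace_diff op_trace_scaleC_id)
  then have "norm A \<le> norm (op_trace A *\<^sub>C op_id - A)"
    using le[of "op_trace A *\<^sub>C op_id - A"] by simp
  then show ?thesis
    using le[of A] by simp
qed

lemma norm_shift_reflect:
  fixes A :: "'h bounded_op"
  shows "norm (A + c *\<^sub>C op_id) = norm (A - (op_trace A + c) *\<^sub>C op_id)"
proof -
  have double: "(2 * c) *\<^sub>C op_id = c *\<^sub>C op_id + c *\<^sub>C (op_id :: 'h bounded_op)"
    by (metis mult_2 scaleC_add_left)
  have "op_trace (A + c *\<^sub>C op_id) *\<^sub>C op_id - (A + c *\<^sub>C op_id)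
      = - (A - (op_trace A + c) *\<^sub>C op_id)"
    unfolding op_trace_add op_trace_scaleC_id scaleC_add_left double
    by simp
  then show ?thesis
    using norm_adjugate[of "A + c *\<^sub>C op_id"] by (simp only: norm_minus_cancel)
qed

section \<open>Symmetry about the origin and vanishing trace\<close>

lemma op_id_nonzero: "(op_id :: 'h bounded_op) \<noteq> 0"
proof
  assume "(op_id :: 'h bounded_op) = 0"
  then have "op_apply op_id e = op_apply 0 e"
    by simp
  then show False
    using norm_e by (simp add: op_id.rep_eq zero_bounded_op.rep_eq)
qed

lemma roberts_orthogonal_id_iff:
  fixes A :: "'h bounded_op"
  shows "A \<bottom>\<^sub>R op_id \<longleftrightarrow> op_trace A = 0"
proof
  assume "op_trace A = 0"
  then show "A \<bottom>\<^sub>R op_id"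
    using norm_shift_reflect[of A] by (simp add: roberts_orthogonal_def)
next
  assume R: "A \<bottom>\<^sub>R op_id"
  have shift: "norm (A + (op_trace A + c) *\<^sub>C op_id) = norm (A + c *\<^sub>C op_id)" for c
    using R norm_shift_reflect[of A c] by (simp add: roberts_orthogonal_def)
  have "norm (A + (of_nat n * op_trace A) *\<^sub>C op_id) = norm A" for n
  proof (induction n)
    case (Suc n)
    then show ?case
      using shift[of "of_nat n * op_trace A"] by (simp add: algebra_simps)
  qed simp
  then have "norm (A + real n *\<^sub>R (op_trace A *\<^sub>C op_id)) \<le> norm A" for n
    by (simp add: scaleR_eq_scaleC scaleC_scaleC)
  then have "op_trace A *\<^sub>C (op_id :: 'h bounded_op) = 0"
    by (rule bounded_translates_imp_zero)
  then show "op_trace A = 0"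
    using op_id_nonzero by (simp add: cvs.scale_eq_0_iff)
qed

lemma numerical_range_symmetric_iff:
  fixes A :: "'h bounded_op"
  shows "numerical_range A = uminus ` numerical_range A \<longleftrightarrow> op_trace A = 0"
proof
  assume "op_trace A = 0"
  then have neg: "- z \<in> numerical_range A" if "z \<in> numerical_range A" for z
    using numerical_range_reflect[OF that] by simp
  then show "numerical_range A = uminus ` numerical_range A"
    by (force simp: image_iff)
next
  assume sym: "numerical_range A = uminus ` numerical_range A"
  have shift: "op_trace A + z \<in> numerical_range A" if "z \<in> numerical_range A" for z
  proof -
    have "- z \<in> numerical_range A"
      using that sym by (metis imageI)
    then show ?thesis
      using numerical_range_reflect[of "- z" A] by simp
  qed
  define z where "z = cinner (op_apply A e) e"
  have "z + real n *\<^sub>R op_trace A \<in> numerical_range A" for n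
  proof (induction n)
    case 0
    then show ?case
      using norm_e by (auto simp: z_def numerical_range_def)
  next
    case (Suc n)
    then show ?case
      using shift[OF Suc.IH] by (simp add: algebra_simps)
  qed
  then have "norm (z + real n *\<^sub>R op_trace A) \<le> norm A" for n
    by (rule numerical_range_bounded)
  then show "op_trace A = 0"
    by (rule bounded_translates_imp_zero)
qed

end

section \<open>Two-dimensional spaces\<close>

text \<open>Gram--Schmidt for a basis \<open>u, v\<close>.  Both \<open>u\<close> and \<open>v\<close> are combinations of the orthonormal pair
  \<open>e, f\<close>, so this pair spans the space, and pairing \<open>x = p e + q f\<close> with \<open>e\<close> and \<open>f\<close> identifies
  the coefficients.\<close>

lemma orthonormal_plane_exists:
  assumes "cvs.dim (UNIV :: 'h::complex_inner set) = 2"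
  obtains e f :: "'h::complex_inner" where "orthonormal_plane e f"
proof -
  obtain B :: "'h set" where B: "cvs.independent B" "UNIV \<subseteq> cvs.span B" "card B = 2"
    using cvs.basis_exists[of "UNIV :: 'h set"] assms by metis
  obtain u v where uv: "B = {u, v}" "u \<noteq> v"
    using B(3) by (auto simp: card_2_iff)
  have normalize: "norm (complex_of_real (1 / norm x) *\<^sub>C x) = 1"
    "x = complex_of_real (norm x) *\<^sub>C complex_of_real (1 / norm x) *\<^sub>C x" if "x \<noteq> 0" for x :: 'h
    using that scaleR_eq_scaleC[of 1 x] by (simp_all add: norm_scaleC norm_divide scaleC_scaleC)
  have u0: "u \<noteq> 0"
    using B(1) uv cvs.dependent_zero[of B] by auto
  define e where "e = complex_of_real (1 / norm u) *\<^sub>C u"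
  have e: "norm e = 1" "u = complex_of_real (norm u) *\<^sub>C e"
    using normalize[OF u0] by (simp_all only: e_def)
  define w where "w = v - cinner v e *\<^sub>C e"
  have "v \<notin> cvs.span {u}"
    using B(1) uv cvs.independent_insert[of v "{u}"] by (simp add: insert_commute)
  moreover have "e \<in> cvs.span {u}"
    unfolding e_def by (intro cvs.span_scale cvs.span_base) simp
  ultimately have w0: "w \<noteq> 0"
    using cvs.span_scale[of e "{u}" "cinner v e"] by (auto simp: w_def)
  define f where "f = complex_of_real (1 / norm w) *\<^sub>C w"
  have f: "norm f = 1" "w = complex_of_real (norm w) *\<^sub>C f"
    using normalize[OF w0] by (simp_all only: f_def)
  have ee: "cinner e e = 1" and ff: "cinner f f = 1"
    using e(1) f(1) by (simp_all add: cinner_self)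
  have fe: "cinner f e = 0"
    by (simp add: f_def w_def cinner_scaleC_left cinner_diff_left ee)
  then have ef: "cinner e f = 0"
    by (subst cinner_commute) simp
  have "x = cinner x e *\<^sub>C e + cinner x f *\<^sub>C f" for x
  proof -
    have in_span: "p *\<^sub>C e + q *\<^sub>C f \<in> cvs.span {e, f}" for p q
      by (intro cvs.span_add cvs.span_scale cvs.span_base; simp)
    have "u \<in> cvs.span {e, f}"
      using in_span[of "norm u" 0] e(2) by simp
    moreover have "v = cinner v e *\<^sub>C e + complex_of_real (norm w) *\<^sub>C f"
      using f(2) by (simp add: w_def)
    then have "v \<in> cvs.span {e, f}"
      using in_span by metis
    ultimately have "cvs.span B \<subseteq> cvs.span {e, f}"
      by (simp add: uv(1) cvs.span_minimal)
    then have "x \<in> cvs.span {e, f}"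
      using B(2) by auto
    then obtain p where "x - p *\<^sub>C e \<in> cvs.span {f}"
      by (auto simp: cvs.span_insert[of e])
    then obtain q where "x - p *\<^sub>C e = q *\<^sub>C f"
      by (auto simp: cvs.span_singleton)
    then have x: "x = p *\<^sub>C e + q *\<^sub>C f"
      by (simp add: diff_eq_eq)
    then have "cinner x e = p" "cinner x f = q"
      by (simp_all add: cinner_add_left cinner_scaleC_left ee ff ef fe)
    then show ?thesis
      using x by simp
  qed
  then have "orthonormal_plane e f"
    using e(1) f(1) ef by unfold_locales
  then show ?thesis
    by (rule that)
qed

theorem proposition2p7:
  fixes A :: "'h::chilbert_space bounded_op"
  assumes "cvs.dim (UNIV :: 'h set) = 2"
  shows "(A \<bottom>\<^sub>R op_id \<longleftrightarrow> numerical_range A = uminus ` numerical_range A)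
    \<and> (numerical_range A = uminus ` numerical_range A \<longleftrightarrow> op_trace A = 0)"
proof -
  obtain e f :: 'h where "orthonormal_plane e f"
    using orthonormal_plane_exists[OF assms] .
  then interpret orthonormal_plane e f .
  show ?thesis
    by (simp add: roberts_orthogonal_id_iff numerical_range_symmetric_iff)
qed

end
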